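(* Let $N\ge 7$ be an odd integer and let $r$ be an integer with $1\le r\le (N-3)/2$. Then for every $\ell\in\{1,2,\dots,(N-1)/2\}$ the effective resistance between the vertices $0$ and $\ell$ of $G_N^{(r)}$ is \[ R(0,\ell)=\frac{4}{N}\sum_{m=1}^{(N-1)/2}\frac{1-\cos\left(\frac{2\pi m\ell}{N}\right)}{(N-2r)+2\sum_{j=1}^{r}\cos\left(\frac{2\pi mj}{N}\right)}. \]
   Context: For odd $N$ and $1\le r\le (N-3)/2$, the graph $G_N^{(r)}$ has vertex set $\mathbb Z/N\mathbb Z$; two distinct vertices $x,y$ are adjacent iff their circular distance $\min\{|x-y|,N-|x-y|\}$ (with representatives in $\{0,\dots,N-1\}$) lies in $\{r+1,\dots,(N-1)/2\}$. For a connected graph with Laplacian matrix $L$ (degree matrix minus adjacency matrix) and Moore--Penrose pseudoinverse $L^+$, the effective resistance between vertices $x,y$ is $R(x,y)=(e_x-e_y)^*L^+(e_x-e_y)$, where $e_x$ are the standard basis vectors. *)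

theory Defs
  imports
    Complex_Main
    "Graph_Theory.Graph_Theory"
    "Jordan_Normal_Form.Schur_Decomposition"
begin

text \<open>A finite simple graph is a symmetric, loop-free \<^typ>\<open>'a pair_pre_digraph\<close>
  (locale \<^locale>\<open>pair_graph\<close>), every undirected edge being represented by its two arcs.
  To index matrices by vertices, the vertex set is \<open>{0..<n}\<close> with \<open>n = card (pverts G)\<close>.\<close>

definition adjacency_mat :: "nat pair_pre_digraph \<Rightarrow> real mat" where
  "adjacency_mat G = mat (card (pverts G)) (card (pverts G))
     (\<lambda>(x, y). if (x, y) \<in> parcs G then 1 else 0)"

definition degree_mat :: "nat pair_pre_digraph \<Rightarrow> real mat" where
  "degree_mat G = mat (card (pverts G)) (card (pverts G))
     (\<lambda>(x, y). if x = y then real (out_degree G x) else 0)"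

definition laplacian_mat :: "nat pair_pre_digraph \<Rightarrow> real mat" where
  "laplacian_mat G = degree_mat G - adjacency_mat G"

text \<open>The four Penrose conditions, which determine \<open>X\<close> uniquely.\<close>

definition is_moore_penrose :: "'a :: conjugatable_field mat \<Rightarrow> 'a mat \<Rightarrow> bool" where
  "is_moore_penrose A X \<longleftrightarrow>
     X \<in> carrier_mat (dim_col A) (dim_row A) \<and>
     A * X * A = A \<and>
     X * A * X = X \<and>
     mat_adjoint (A * X) = A * X \<and>
     mat_adjoint (X * A) = X * A"

definition pseudoinverse :: "'a :: conjugatable_field mat \<Rightarrow> 'a mat" where
  "pseudoinverse A = (THE X. is_moore_penrose A X)"

text \<open>Only meaningful for connected \<open>G\<close>. Since the matrices are real, the form
  \<open>v\<^sup>* L\<^sup>+ v\<close> is the plain scalar product of \<open>v\<close> with \<open>L\<^sup>+ v\<close>.\<close>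

definition effective_resistance :: "nat pair_pre_digraph \<Rightarrow> nat \<Rightarrow> nat \<Rightarrow> real" where
  "effective_resistance G x y =
     (let n = card (pverts G); v = unit_vec n x - unit_vec n y
      in v \<bullet> (pseudoinverse (laplacian_mat G) *\<^sub>v v))"

text \<open>Residue classes modulo \<open>N\<close> are given by their representatives in \<open>{0..<N}\<close>.\<close>

definition circ_dist :: "nat \<Rightarrow> nat \<Rightarrow> nat \<Rightarrow> int" where
  "circ_dist N x y = min \<bar>int x - int y\<bar> (int N - \<bar>int x - int y\<bar>)"

definition far_graph :: "nat \<Rightarrow> nat \<Rightarrow> nat pair_pre_digraph" where
  "far_graph N r =
     \<lparr> pverts = {0..<N},
       parcs = {(x, y). x \<in> {0..<N} \<and> y \<in> {0..<N} \<and> x \<noteq> y \<and>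
                  circ_dist N x y \<in> {int r + 1..(int N - 1) div 2}} \<rparr>"

lemma pair_graph_far_graph: "pair_graph (far_graph N r)"
proof
  show "finite (parcs (far_graph N r))"
    by (rule finite_subset[of _ "{0..<N} \<times> {0..<N}"]) (auto simp: far_graph_def)
qed (auto simp: far_graph_def circ_dist_def abs_minus_commute symmetric_def intro!: symI)

text \<open>Hence the effective resistances of \<^term>\<open>far_graph N r\<close> are defined for the
  parameters considered.\<close>

lemma connected_far_graph:
  assumes "odd N" and "N \<ge> 7" and "r \<le> (N - 3) div 2"
  shows "connected (far_graph N r)"
proof -
  let ?G = "far_graph N r"
  interpret pair_graph ?G by (rule pair_graph_far_graph)
  obtain h where N: "N = 2 * h + 1" using assms(1) by (elim oddE)
  have r: "r + 1 \<le> h" using assms N by auto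
  have step: "x \<rightarrow>\<^sup>*\<^bsub>?G\<^esub> Suc x" if "Suc x < N" for x
  proof -
    define z where "z = (if x + h + 1 < N then x + h + 1 else x - h)"
    have arcs: "(x, z) \<in> parcs ?G" "(z, Suc x) \<in> parcs ?G"
      using that N r unfolding z_def by (auto simp: far_graph_def circ_dist_def)
    show ?thesis by (rule reachable_trans[OF arcs[THEN reachable_adjI]])
  qed
  have zero: "0 \<rightarrow>\<^sup>*\<^bsub>?G\<^esub> x" if "x < N" for x
    using that
  proof (induction x)
    case 0
    then show ?case by (intro reachable_refl) (auto simp: far_graph_def)
  next
    case (Suc x)
    then have "0 \<rightarrow>\<^sup>*\<^bsub>?G\<^esub> x" by simp
    then show ?case using step[OF Suc.prems] by (rule reachable_trans)
  qed
  show ?thesis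
  proof (rule connectedI)
    show "pverts ?G \<noteq> {}" using assms(2) by (auto simp: far_graph_def)
  next
    fix u v assume "u \<in> pverts ?G" "v \<in> pverts ?G"
    then have "u < N" "v < N" by (simp_all add: far_graph_def)
    then have u: "0 \<rightarrow>\<^sup>*\<^bsub>?G\<^esub> u" and v: "0 \<rightarrow>\<^sup>*\<^bsub>?G\<^esub> v"
      by (simp_all add: zero)
    have "u \<rightarrow>\<^sup>*\<^bsub>?G\<^esub> v"
      using symmetric_reachable'[OF u] v by (rule reachable_trans)
    then show "u \<rightarrow>\<^sup>*\<^bsub>mk_symmetric ?G\<^esub> v"
      by (rule reachable_mk_symmetricI)
  qed
qed

end

theory Submission
  imports Defs
begin

text \<open>The Laplacian \<open>L\<close> of the graph is circulant, so the waves
  \<open>z \<mapsto> cos (2 \<pi> m (z - y) / N)\<close> are eigenvectors, with eigenvalue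
  \<open>\<lambda>\<^sub>m = \<Sum>\<^sub>d (1 - cos (2 \<pi> m d / N))\<close> over \<open>r < d < N - r\<close>. For \<open>0 < m < N\<close> this is positive:
  \<open>d = (N - 1) / 2\<close> generates the residues modulo \<open>N\<close>. Inverting the nonzero eigenvalues gives an
  explicit symmetric \<open>X\<close> with \<open>L X = X L = I - J / N\<close>, which satisfies the Penrose conditions.
  The quadratic form of \<open>X\<close> is a sum over \<open>0 < m < N\<close>, which is folded by \<open>m \<mapsto> N - m\<close>.\<close>

subsection \<open>The Moore--Penrose pseudoinverse\<close>

lemma dim_mat_adjoint [simp]:
  "dim_row (mat_adjoint A) = dim_col A" "dim_col (mat_adjoint A) = dim_row A"
  by (simp_all add: mat_adjoint_def)

lemma index_mat_adjoint [simp]: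
  "i < dim_col A \<Longrightarrow> j < dim_row A \<Longrightarrow> mat_adjoint A $$ (i, j) = conjugate (A $$ (j, i))"
  by (simp add: mat_adjoint_def mat_of_rows_index)

lemma mat_adjoint_mult:
  fixes A B :: "'a :: conjugatable_field mat"
  assumes "dim_col A = dim_row B"
  shows "mat_adjoint (A * B) = mat_adjoint B * mat_adjoint A"
  using assms
  by (intro eq_matI)
    (auto simp: scalar_prod_def sum_conjugate conjugate_dist_mul mult.commute intro!: sum.cong)

text \<open>\<open>A * X\<close> and \<open>A * Y\<close> are self-adjoint, and \<open>A * Y\<close>
  fixes \<open>A * X\<close> from the left. Adjoining swaps the factors, which forces
  \<open>A * X = A * Y\<close>; dually \<open>X * A = Y * A\<close>. Then
  \<open>X = X A X = Y A X = Y A Y = Y\<close>.\<close>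

lemma is_moore_penrose_unique:
  fixes A X Y :: "'a :: conjugatable_field mat"
  assumes X: "is_moore_penrose A X" and Y: "is_moore_penrose A Y"
  shows "X = Y"
proof -
  define m n where "m = dim_row A" and "n = dim_col A"
  have A: "A \<in> carrier_mat m n" by (auto simp: m_def n_def)
  have cX: "X \<in> carrier_mat n m" and cY: "Y \<in> carrier_mat n m"
    using X Y by (auto simp: is_moore_penrose_def m_def n_def)
  have pX: "A * X * A = A" "X * A * X = X" "mat_adjoint (A * X) = A * X" "mat_adjoint (X * A) = X * A"
    and pY: "A * Y * A = A" "Y * A * Y = Y" "mat_adjoint (A * Y) = A * Y" "mat_adjoint (Y * A) = Y * A"
    using X Y by (auto simp: is_moore_penrose_def)
  have "A * X = (A * Y) * (A * X)"
    using assoc_mult_mat[of "A * Y" m m A n X m] A cX cY pY(1) by simp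
  then have "A * X = mat_adjoint ((A * Y) * (A * X))" using pX(3) by simp
  also have "\<dots> = (A * X) * (A * Y)"
    using A cX cY pX pY by (subst mat_adjoint_mult) auto
  also have "\<dots> = A * Y"
    using assoc_mult_mat[of "A * X" m m A n Y m] A cX cY pX(1) by simp
  finally have AX: "A * X = A * Y" .
  have "X * A = (X * A) * (Y * A)"
    using assoc_mult_mat[of X n m A n "Y * A" n] assoc_mult_mat[of A m n Y m A n]
      A cX cY pY(1) by simp
  then have "X * A = mat_adjoint ((X * A) * (Y * A))" using pX(4) by simp
  also have "\<dots> = (Y * A) * (X * A)"
    using A cX cY pX pY by (subst mat_adjoint_mult) auto
  also have "\<dots> = Y * A"
    using assoc_mult_mat[of Y n m A n "X * A" n] assoc_mult_mat[of A m n X m A n]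
      A cX cY pX(1) by simp
  finally have XA: "X * A = Y * A" .
  have "X = Y * (A * X)" using pX(2) XA A cX cY assoc_mult_mat[of Y n m A n X m] by simp
  also have "\<dots> = Y * A * Y" using AX A cY assoc_mult_mat[of Y n m A n Y m] by simp
  finally show ?thesis using pY(2) by simp
qed

lemma pseudoinverse_eqI: "is_moore_penrose A X \<Longrightarrow> pseudoinverse A = X"
  unfolding pseudoinverse_def by (rule the_equality) (auto intro: is_moore_penrose_unique)

subsection \<open>Trigonometric sums over residue classes\<close>

lemma cos_eq_1_imp_dvd:
  fixes k :: int
  assumes "N > 0" and "cos (2 * pi * of_int k / real N) = 1"
  shows "int N dvd k"
proof -
  obtain n :: int where "2 * pi * of_int k / real N = of_int n * 2 * pi"
    using assms(2) by (auto simp: cos_one_2pi_int)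
  then have "of_int k = (of_int (n * int N) :: real)" using assms(1) by (simp add: field_simps)
  then have "k = n * int N" by (simp only: of_int_eq_iff)
  then show ?thesis by simp
qed

text \<open>A geometric sum whose ratio is an \<open>N\<close>-th root of unity different from
  1.\<close>

lemma sum_cis_eq_0:
  fixes k :: int
  assumes "N > 0" and "\<not> int N dvd k"
  shows "(\<Sum>m<N. cis (2 * pi * real m * of_int k / real N)) = 0"
proof -
  let ?w = "cis (2 * pi * of_int k / real N)"
  have ne: "?w \<noteq> 1" using cos_eq_1_imp_dvd[of N k] assms by (auto simp: complex_eq_iff)
  have "?w ^ N = cis (2 * pi * of_int k)" using assms(1) by (simp add: DeMoivre)
  also have "\<dots> = 1" by (simp add: cis_multiple_2pi)
  finally have wN: "?w ^ N = 1" .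
  have "(\<Sum>m<N. cis (2 * pi * real m * of_int k / real N)) = (\<Sum>m<N. ?w ^ m)"
    by (simp add: DeMoivre mult_ac)
  also have "\<dots> = 0" using ne wN by (simp add: geometric_sum)
  finally show ?thesis .
qed

lemma sum_cos_eq_0:
  fixes k :: int
  assumes "N > 0" and "\<not> int N dvd k"
  shows "(\<Sum>m<N. cos (2 * pi * real m * of_int k / real N)) = 0"
  using arg_cong[OF sum_cis_eq_0[OF assms], of Re] by simp

text \<open>The two angles add up to whole turns because \<open>k\<close> is an integer. As
  \<open>m\<close> and \<open>k\<close> enter symmetrically, this reflects distances as well as
  frequencies.\<close>

lemma cos_reflect:
  fixes k :: int
  assumes "m \<le> N" and "N > 0"
  shows "cos (2 * pi * real (N - m) * of_int k / real N) = cos (2 * pi * real m * of_int k / real N)"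
proof -
  have "2 * pi * real (N - m) * of_int k / real N
      = 2 * pi * of_int k - 2 * pi * real m * of_int k / real N"
    using assms by (simp add: field_simps of_nat_diff)
  then show ?thesis by (simp add: cos_diff)
qed

lemma sin_reflect:
  fixes k :: int
  assumes "m \<le> N" and "N > 0"
  shows "sin (2 * pi * real (N - m) * of_int k / real N) = - sin (2 * pi * real m * of_int k / real N)"
proof -
  have "2 * pi * real (N - m) * of_int k / real N
      = 2 * pi * of_int k - 2 * pi * real m * of_int k / real N"
    using assms by (simp add: field_simps of_nat_diff)
  then show ?thesis by (simp add: sin_diff)
qed

lemma cos_periodic_mod:
  fixes k :: int
  assumes "N > 0"
  shows "cos (2 * pi * real m * of_int (k mod int N) / real N) = cos (2 * pi * real m * of_int k / real N)"
proof -
  have "real_of_int k = of_int (k div int N * int N + k mod int N)" by simp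
  also have "\<dots> = of_int (k div int N) * real N + of_int (k mod int N)"
    by (simp only: of_int_add of_int_mult of_int_of_nat_eq)
  finally have k: "real_of_int k = of_int (k div int N) * real N + of_int (k mod int N)" .
  have "2 * pi * real m * of_int k / real N
     = 2 * pi * of_int (int m * (k div int N)) + 2 * pi * real m * of_int (k mod int N) / real N"
    unfolding k using assms by (simp add: field_simps)
  then show ?thesis by (simp only: cos_add cos_int_2pin sin_int_2pin)
qed

text \<open>Subtraction from a fixed \<open>x\<close> modulo \<open>N\<close> is an involution of
  the residues, so one map serves as both witnesses of the bijection.\<close>

lemma sum_cyclic_shift:
  fixes g :: "int \<Rightarrow> 'a :: comm_monoid_add"
  assumes "N > 0"
  shows "(\<Sum>z<N. g ((x - int z) mod int N)) = (\<Sum>d<N. g (int d))"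
proof (rule sum.reindex_bij_witness[where i = "\<lambda>d. nat ((x - int d) mod int N)"
        and j = "\<lambda>d. nat ((x - int d) mod int N)"])
  fix a assume a: "a \<in> {..<N}"
  show "nat ((x - int (nat ((x - int a) mod int N))) mod int N) = a"
    using a assms by (simp add: mod_diff_right_eq)
  show "nat ((x - int a) mod int N) \<in> {..<N}" using assms by (simp add: nat_less_iff)
qed (use assms in \<open>auto simp: mod_diff_right_eq nat_less_iff\<close>)

subsection \<open>The Laplacian and its pseudoinverse\<close>

text \<open>A residue \<open>d\<close> has circular distance \<open>min d (N - d)\<close>. For
  \<open>N = 2 * h + 1\<close> the range \<open>r + 1..h\<close> and its mirror image
  \<open>h + 1..N - 1 - r\<close> join without a gap, so the circulant has an interval as its
  connection set.\<close>

lemma far_graph_arc_iff: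
  assumes "odd N" and "x < N" and "z < N" and "r \<le> (N - 3) div 2" and "N \<ge> 3"
  shows "(x, z) \<in> parcs (far_graph N r) \<longleftrightarrow>
    (int x - int z) mod int N \<in> {int r + 1..int N - 1 - int r}"
proof -
  obtain h where N: "N = 2 * h + 1" using assms(1) by (elim oddE)
  have r: "r + 1 \<le> h" using assms N by auto
  have "(int x - int z) mod int N = (if z \<le> x then int x - int z else int x - int z + int N)"
  proof (cases "z \<le> x")
    case True
    then show ?thesis using assms by simp
  next
    case False
    have "(int x - int z) mod int N = (int x - int z + int N) mod int N" by simp
    also have "\<dots> = int x - int z + int N"
      using False assms by (intro mod_pos_pos_trivial) auto
    finally show ?thesis using False by simp
  qed
  then show ?thesis
    using assms N r by (auto simp: far_graph_def circ_dist_def)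
qed

text \<open>Turns a sum over neighbours of \<open>x\<close> into one over differences, whose range
  does not depend on \<open>x\<close>. Periodicity makes each summand a function of the residue of
  \<open>x - z\<close>, so the cyclic shift applies.\<close>

lemma sum_far_graph_arcs:
  fixes g :: "int \<Rightarrow> real"
  assumes "odd N" and "x < N" and "r \<le> (N - 3) div 2" and "N \<ge> 3"
    and per: "\<And>k. g (k mod int N) = g k"
  shows "(\<Sum>z<N. if (x, z) \<in> parcs (far_graph N r) then g (int z) else 0)
    = (\<Sum>d = r + 1..N - 1 - r. g (int x - int d))"
proof -
  let ?f = "\<lambda>k. if k \<in> {int r + 1..int N - 1 - int r} then g (int x - k) else 0"
  have "g (int x - (int x - int z) mod int N) = g (int z)" for z
  proof -
    have "g (int x - (int x - int z) mod int N)
      = g ((int x - (int x - int z) mod int N) mod int N)" by (simp only: per)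
    also have "\<dots> = g (int z mod int N)" by (simp only: mod_diff_right_eq) simp
    finally show ?thesis by (simp only: per)
  qed
  then have "(\<Sum>z<N. if (x, z) \<in> parcs (far_graph N r) then g (int z) else 0)
      = (\<Sum>z<N. ?f ((int x - int z) mod int N))"
    using assms by (intro sum.cong refl) (simp add: far_graph_arc_iff del: atLeastAtMost_iff)
  also have "\<dots> = (\<Sum>d<N. ?f (int d))" using assms by (intro sum_cyclic_shift) simp
  also have "\<dots> = (\<Sum>d = r + 1..N - 1 - r. ?f (int d))"
    using assms by (intro sum.mono_neutral_right) auto
  also have "\<dots> = (\<Sum>d = r + 1..N - 1 - r. g (int x - int d))"
    using assms by (intro sum.cong) auto
  finally show ?thesis .
qed

section \<open>Eigenvalues of the Laplacian: positivity and closed form\<close>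

text \<open>In this form all summands are visibly nonnegative; \<open>far_eigenvalue_eq\<close>
  converts it into the denominator of the theorem.\<close>

definition far_eigenvalue :: "nat \<Rightarrow> nat \<Rightarrow> nat \<Rightarrow> real" where
  "far_eigenvalue N r m = (\<Sum>d = r + 1..N - 1 - r. 1 - cos (2 * pi * real m * real d / real N))"

lemma far_eigenvalue_pos:
  assumes "odd N" and "r \<le> (N - 3) div 2" and "N \<ge> 3" and "0 < m" and "m < N"
  shows "far_eigenvalue N r m > 0"
proof -
  obtain h where N: "N = 2 * h + 1" using assms(1) by (elim oddE)
  \<comment> \<open>One strictly positive summand suffices. The difference \<open>h\<close> lies in
    the range because \<open>r + 1 \<le> h\<close>.\<close>
  have "cos (2 * pi * real m * real h / real N) \<noteq> 1"
  proof
    assume "cos (2 * pi * real m * real h / real N) = 1"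
    then have "int N dvd int m * int h"
      using cos_eq_1_imp_dvd[of N "int m * int h"] assms by (simp add: mult_ac)
    then obtain n where "int m * int h = int N * n" by (elim dvdE)
    \<comment> \<open>Double \<open>m * h = N * n\<close> and replace \<open>2 * h\<close> by
      \<open>N - 1\<close>.\<close>
    then have "int m = (int m - 2 * n) * int N" using N by (simp add: algebra_simps)
    then have "int N dvd int m" by (metis dvd_triv_right)
    then show False using assms by (auto dest: dvd_imp_le)
  qed
  then have "1 - cos (2 * pi * real m * real h / real N) > 0"
    using cos_le_one[of "2 * pi * real m * real h / real N"] by linarith
  then show ?thesis
    unfolding far_eigenvalue_def using assms N by (intro sum_pos2[of _ h]) auto
qed

lemma far_eigenvalue_reflect:
  assumes "m \<le> N" and "N > 0"
  shows "far_eigenvalue N r (N - m) = far_eigenvalue N r m"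
  using cos_reflect[OF assms, of "int d" for d] by (simp add: far_eigenvalue_def)

text \<open>The cosines over all residues sum to 0. Removing the residue 0 and the two mirror-image
  blocks of length \<open>r\<close> leaves the connection set, so the long sum is expressed by the
  short one.\<close>

lemma far_eigenvalue_eq:
  assumes "odd N" and "r \<le> (N - 3) div 2" and "N \<ge> 3" and "0 < m" and "m < N"
  shows "far_eigenvalue N r m =
    (real N - 2 * real r) + 2 * (\<Sum>j = 1..r. cos (2 * pi * real m * real j / real N))"
proof -
  let ?c = "\<lambda>d. cos (2 * pi * real m * real d / real N)"
  have r: "2 * r + 3 \<le> N" using assms by auto
  have "\<not> int N dvd int m" using assms by (auto dest: dvd_imp_le)
  then have "0 = (\<Sum>d<N. ?c d)"
    using sum_cos_eq_0[of N "int m"] assms by (simp add: mult_ac)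
  also have "{..<N} = {0} \<union> ({1..r} \<union> ({r + 1..N - 1 - r} \<union> {N - r..N - 1}))"
    using r by auto
  also have "(\<Sum>d\<in>\<dots>. ?c d) = 1 + (sum ?c {1..r} + (sum ?c {r + 1..N - 1 - r} + sum ?c {N - r..N - 1}))"
    using r by (subst sum.union_disjoint; (subst sum.union_disjoint)?; (subst sum.union_disjoint)?) auto
  also have "sum ?c {N - r..N - 1} = sum ?c {1..r}"
  proof (rule sum.reindex_bij_witness[where i = "\<lambda>j. N - j" and j = "\<lambda>j. N - j"])
    fix a assume "a \<in> {N - r..N - 1}"
    then have "a \<le> N" by auto
    then show "?c (N - a) = ?c a"
      using cos_reflect[of a N "int m"] assms by (simp add: mult_ac del: of_nat_diff)
  qed (use r in auto)
  finally have "sum ?c {r + 1..N - 1 - r} = - 1 - 2 * sum ?c {1..r}" by simp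
  \<comment> \<open>The number of differences in the connection set; the cosine of residue 0
    supplies the 1 that raises it to \<open>N - 2 * r\<close>.\<close>
  moreover have "real (N - 1 - r - r) = real N - 1 - 2 * real r" using r by simp
  ultimately show ?thesis using r by (simp add: far_eigenvalue_def sum_subtractf)
qed

section \<open>Action of the Laplacian on periodic functions\<close>

lemma laplacian_far_graph_carrier [simp]:
  "laplacian_mat (far_graph N r) \<in> carrier_mat N N"
  unfolding laplacian_mat_def
  by (rule minus_carrier_mat) (simp add: adjacency_mat_def far_graph_def)

lemma out_degree_far_graph:
  assumes "odd N" and "x < N" and "r \<le> (N - 3) div 2" and "N \<ge> 3"
  shows "real (out_degree (far_graph N r) x) = (\<Sum>d = r + 1..N - 1 - r. 1)"
proof -
  let ?E = "parcs (far_graph N r)"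
  have "out_arcs (far_graph N r) x = Pair x ` {z. z < N \<and> (x, z) \<in> ?E}"
    by (auto simp: out_arcs_def far_graph_def)
  then have "real (out_degree (far_graph N r) x) = real (card {z. z < N \<and> (x, z) \<in> ?E})"
    by (simp add: out_degree_def card_image inj_on_def)
  also have "\<dots> = (\<Sum>z<N. if (x, z) \<in> ?E then 1 else 0)"
    by (simp add: sum.If_cases Collect_conj_eq lessThan_def)
  also have "\<dots> = (\<Sum>d = r + 1..N - 1 - r. 1)"
    using assms by (rule sum_far_graph_arcs) simp
  finally show ?thesis .
qed

text \<open>The degree and the neighbour sum range over the same differences, so the Laplacian acts
  on \<open>N\<close>-periodic functions as a sum of difference operators.\<close>

lemma sum_laplacian_far_graph:
  fixes g :: "int \<Rightarrow> real"
  assumes "odd N" and x: "x < N" and "r \<le> (N - 3) div 2" and "N \<ge> 3"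
    and "\<And>k. g (k mod int N) = g k"
  shows "(\<Sum>z<N. laplacian_mat (far_graph N r) $$ (x, z) * g (int z))
    = (\<Sum>d = r + 1..N - 1 - r. g (int x) - g (int x - int d))"
proof -
  let ?G = "far_graph N r"
  have "(\<Sum>z<N. laplacian_mat ?G $$ (x, z) * g (int z))
    = (\<Sum>z<N. (if z = x then real (out_degree ?G x) * g (int x) else 0)
         - (if (x, z) \<in> parcs ?G then g (int z) else 0))"
    using x by (intro sum.cong refl)
      (auto simp: laplacian_mat_def adjacency_mat_def degree_mat_def far_graph_def)
  also have "\<dots> = real (out_degree ?G x) * g (int x)
      - (\<Sum>z<N. if (x, z) \<in> parcs ?G then g (int z) else 0)"
    using x by (simp add: sum_subtractf)
  finally show ?thesis
    using assms by (simp add: out_degree_far_graph sum_far_graph_arcs sum_subtractf)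
qed

text \<open>The addition formula splits the wave shifted by \<open>d\<close> into a cosine and a
  sine part. The sine parts cancel because the connection set is symmetric. The phase
  \<open>y\<close> is kept since column \<open>y\<close> of \<open>far_pinv\<close> is built from
  these waves.\<close>

lemma sum_laplacian_far_graph_cos:
  assumes "odd N" and "x < N" and "r \<le> (N - 3) div 2" and "N \<ge> 3"
  shows "(\<Sum>z<N. laplacian_mat (far_graph N r) $$ (x, z) *
      cos (2 * pi * real m * of_int (int z - int y) / real N))
    = far_eigenvalue N r m * cos (2 * pi * real m * of_int (int x - int y) / real N)"
proof -
  let ?c = "\<lambda>k. cos (2 * pi * real m * of_int k / real N)"
  let ?s = "\<lambda>k. sin (2 * pi * real m * of_int k / real N)"
  let ?D = "{r + 1..N - 1 - r}"
  have r: "2 * r + 3 \<le> N" using assms by auto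
  \<comment> \<open>Both arguments have the same residue modulo \<open>N\<close>.\<close>
  have per: "?c (k mod int N - int y) = ?c (k - int y)" for k
    using cos_periodic_mod[of N m "k mod int N - int y"] cos_periodic_mod[of N m "k - int y"] assms
    by (simp only: mod_diff_left_eq)
  \<comment> \<open>Reflection \<open>d \<mapsto> N - d\<close> preserves \<open>?D\<close> and
    negates the sine, so the sum equals its own negative.\<close>
  have "(\<Sum>d\<in>?D. ?s (int d)) = (\<Sum>d\<in>?D. - ?s (int d))"
  proof (rule sum.reindex_bij_witness[where i = "\<lambda>j. N - j" and j = "\<lambda>j. N - j"])
    fix a assume "a \<in> ?D"
    then have "a \<le> N" by auto
    then show "- ?s (int (N - a)) = ?s (int a)"
      using sin_reflect[of a N "int m"] assms by (simp add: mult_ac del: of_nat_diff)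
  qed (use r in auto)
  then have s0: "(\<Sum>d\<in>?D. ?s (int d)) = 0" by (simp add: sum_negf)
  have "?c (int x - int d - int y) = ?c (int x - int y) * ?c (int d) + ?s (int x - int y) * ?s (int d)" for d
    by (simp flip: cos_diff) (simp add: algebra_simps diff_divide_distrib add_divide_distrib)
  then have "(\<Sum>d\<in>?D. ?c (int x - int y) - ?c (int x - int d - int y))
    = (\<Sum>d\<in>?D. ?c (int x - int y) * (1 - ?c (int d)) - ?s (int x - int y) * ?s (int d))"
    by (simp add: algebra_simps)
  also have "\<dots> = ?c (int x - int y) * far_eigenvalue N r m"
    using s0 by (simp add: sum_subtractf far_eigenvalue_def flip: sum_distrib_left)
  finally show ?thesis
    using sum_laplacian_far_graph[OF assms, of "\<lambda>k. ?c (k - int y)"] per by (simp add: mult_ac)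
qed

section \<open>The explicit pseudoinverse\<close>

text \<open>The spectral decomposition with inverted eigenvalues. Frequencies \<open>m\<close> and
  \<open>N - m\<close> share an eigenvalue, so the imaginary parts of the Fourier projectors cancel
  and cosines remain. Frequency 0, the constant vectors in the kernel, is omitted.\<close>

definition far_pinv :: "nat \<Rightarrow> nat \<Rightarrow> real mat" where
  "far_pinv N r = mat N N (\<lambda>(x, y). 1 / real N *
     (\<Sum>m = 1..<N. cos (2 * pi * real m * of_int (int x - int y) / real N) / far_eigenvalue N r m))"

text \<open>The orthogonal projection onto the vectors with coordinate sum 0.\<close>

definition centering_mat :: "nat \<Rightarrow> real mat" where
  "centering_mat N = mat N N (\<lambda>(x, y). (if x = y then 1 else 0) - 1 / real N)"

text \<open>Over all frequencies the sum is \<open>N\<close> or 0, as two representatives are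
  congruent only if equal. Frequency 0 contributes 1, which accounts for the subtracted
  \<open>1 / N\<close>.\<close>

lemma sum_nonzero_frequencies_cos:
  assumes "x < N" and "y < N"
  shows "1 / real N * (\<Sum>m = 1..<N. cos (2 * pi * real m * of_int (int x - int y) / real N))
    = (if x = y then 1 else 0) - 1 / real N"
proof -
  let ?c = "\<lambda>m. cos (2 * pi * real m * of_int (int x - int y) / real N)"
  have "(\<Sum>m<N. ?c m) = ?c 0 + (\<Sum>m = 1..<N. ?c m)"
    using assms by (simp add: lessThan_atLeast0 sum.atLeast_Suc_lessThan)
  moreover have "(\<Sum>m<N. ?c m) = (if x = y then real N else 0)"
  proof (cases "x = y")
    case False
    have "\<not> int N dvd int x - int y"
    proof
      assume "int N dvd int x - int y"
      then have "int N \<le> \<bar>int x - int y\<bar>" using False by (intro zdvd_imp_le) auto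
      then show False using assms by linarith
    qed
    then show ?thesis using sum_cos_eq_0[of N "int x - int y"] assms False by simp
  qed simp
  ultimately show ?thesis using assms by (simp add: field_simps)
qed

lemma laplacian_mult_far_pinv:
  assumes "odd N" and "r \<le> (N - 3) div 2" and "N \<ge> 3"
  shows "laplacian_mat (far_graph N r) * far_pinv N r = centering_mat N"
proof (rule eq_matI)
  let ?L = "laplacian_mat (far_graph N r)"
  let ?c = "\<lambda>m k. cos (2 * pi * real m * of_int k / real N)"
  fix x y assume "x < dim_row (centering_mat N)" and "y < dim_col (centering_mat N)"
  then have xy: "x < N" "y < N" by (auto simp: centering_mat_def)
  have L: "?L \<in> carrier_mat N N" by simp
  have "(?L * far_pinv N r) $$ (x, y) = (\<Sum>z<N. ?L $$ (x, z) * (1 / real N *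
     (\<Sum>m = 1..<N. ?c m (int z - int y) / far_eigenvalue N r m)))"
    using xy carrier_matD[OF L] by (simp add: scalar_prod_def far_pinv_def lessThan_atLeast0)
  also have "\<dots> = 1 / real N * (\<Sum>m = 1..<N. (\<Sum>z<N. ?L $$ (x, z) * ?c m (int z - int y)) / far_eigenvalue N r m)"
    unfolding sum_distrib_left sum_divide_distrib
    by (subst sum.swap) (simp add: mult_ac)
  \<comment> \<open>Each wave is multiplied by its eigenvalue, which cancels against the denominator
    because it is positive.\<close>
  also have "\<dots> = 1 / real N * (\<Sum>m = 1..<N. ?c m (int x - int y))"
    using far_eigenvalue_pos[of N r] assms xy
    by (subst sum_laplacian_far_graph_cos)
      (auto intro!: sum.cong simp: less_imp_neq[THEN not_sym])
  also have "\<dots> = centering_mat N $$ (x, y)"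
    using sum_nonzero_frequencies_cos[OF xy] xy by (simp add: centering_mat_def)
  finally show "(?L * far_pinv N r) $$ (x, y) = centering_mat N $$ (x, y)" .
qed (auto simp: centering_mat_def far_pinv_def carrier_matD[OF laplacian_far_graph_carrier])


lemma adjoint_laplacian_far_graph:
  "mat_adjoint (laplacian_mat (far_graph N r)) = laplacian_mat (far_graph N r)"
proof (rule eq_matI)
  let ?L = "laplacian_mat (far_graph N r)"
  note dims = carrier_matD[OF laplacian_far_graph_carrier]
  interpret pair_graph "far_graph N r" by (rule pair_graph_far_graph)
  fix x y assume "x < dim_row ?L" and "y < dim_col ?L"
  then have xy: "x < N" "y < N" by (auto simp: dims)
  have "(x, y) \<in> parcs (far_graph N r) \<longleftrightarrow> (y, x) \<in> parcs (far_graph N r)"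
    by (auto intro: arcs_symmetric)
  then have "?L $$ (y, x) = ?L $$ (x, y)"
    using xy by (simp add: laplacian_mat_def adjacency_mat_def degree_mat_def) (simp add: far_graph_def)
  then show "mat_adjoint ?L $$ (x, y) = ?L $$ (x, y)" using xy by (simp add: dims)
qed (simp_all add: carrier_matD[OF laplacian_far_graph_carrier])

lemma adjoint_far_pinv: "mat_adjoint (far_pinv N r) = far_pinv N r"
proof (rule eq_matI)
  fix x y assume "x < dim_row (far_pinv N r)" and "y < dim_col (far_pinv N r)"
  moreover have "cos (2 * pi * real m * of_int (int y - int x) / real N)
      = cos (2 * pi * real m * of_int (int x - int y) / real N)" for m
    using cos_minus[of "2 * pi * real m * of_int (int x - int y) / real N"]
    by (simp only: minus_divide_left mult_minus_right[symmetric] of_int_minus[symmetric] minus_diff_eq)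
  ultimately show "mat_adjoint (far_pinv N r) $$ (x, y) = far_pinv N r $$ (x, y)"
    by (simp add: far_pinv_def)
qed (simp_all add: far_pinv_def)

lemma adjoint_centering_mat: "mat_adjoint (centering_mat N) = centering_mat N"
  by (rule eq_matI) (auto simp: centering_mat_def)

text \<open>Multiplication by the centering matrix from the right subtracts from each row its mean,
  here 0.\<close>

lemma mult_centering_mat:
  assumes A: "A \<in> carrier_mat k N" and row: "\<And>x. x < k \<Longrightarrow> (\<Sum>z<N. A $$ (x, z)) = 0"
  shows "A * centering_mat N = A"
proof (rule eq_matI)
  fix x y assume "x < dim_row A" and "y < dim_col A"
  then have xy: "x < k" "y < N" using A by auto
  have "(A * centering_mat N) $$ (x, y)
      = (\<Sum>z<N. (if z = y then A $$ (x, y) else 0) - A $$ (x, z) / real N)"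
    using xy A by (auto simp: scalar_prod_def centering_mat_def lessThan_atLeast0 algebra_simps
        intro!: sum.cong)
  also have "\<dots> = A $$ (x, y) - (\<Sum>z<N. A $$ (x, z)) / real N"
    using xy by (simp add: sum_subtractf sum_divide_distrib)
  finally show "(A * centering_mat N) $$ (x, y) = A $$ (x, y)" using row xy by simp
qed (use A in \<open>auto simp: centering_mat_def\<close>)

text \<open>Every wave of nonzero frequency sums to 0 over a full period, wherever the period
  starts.\<close>

lemma sum_far_pinv_row:
  assumes "x < N"
  shows "(\<Sum>z<N. far_pinv N r $$ (x, z)) = 0"
proof -
  let ?c = "\<lambda>m k. cos (2 * pi * real m * of_int k / real N)"
  have 0: "(\<Sum>z<N. ?c m (int x - int z)) = 0" if "m \<in> {1..<N}" for m
  proof -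
    have "(\<Sum>z<N. ?c m (int x - int z)) = (\<Sum>z<N. ?c m ((int x - int z) mod int N))"
      using assms by (simp only: cos_periodic_mod)
    also have "\<dots> = (\<Sum>d<N. ?c m (int d))" using assms by (intro sum_cyclic_shift) simp
    also have "\<dots> = 0"
      using sum_cos_eq_0[of N "int m"] that nat_dvd_not_less[of m N] by (simp add: mult_ac)
    finally show ?thesis .
  qed
  have "(\<Sum>z<N. far_pinv N r $$ (x, z))
      = 1 / real N * (\<Sum>m = 1..<N. (\<Sum>z<N. ?c m (int x - int z)) / far_eigenvalue N r m)"
    unfolding sum_distrib_left sum_divide_distrib using assms
    by (subst sum.swap) (simp add: far_pinv_def sum_divide_distrib mult_ac)
  also have "\<dots> = 0" by (simp only: 0 cong: sum.cong) simp
  finally show ?thesis .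
qed

lemma is_moore_penrose_far_pinv:
  assumes "odd N" and "r \<le> (N - 3) div 2" and "N \<ge> 3"
  shows "is_moore_penrose (laplacian_mat (far_graph N r)) (far_pinv N r)"
proof -
  let ?L = "laplacian_mat (far_graph N r)" and ?X = "far_pinv N r"
  have L: "?L \<in> carrier_mat N N" and X: "?X \<in> carrier_mat N N" by (simp_all add: far_pinv_def)
  note dims = carrier_matD[OF L] carrier_matD[OF X]
  have LX: "?L * ?X = centering_mat N" using assms by (rule laplacian_mult_far_pinv)
  \<comment> \<open>Adjoining \<open>LX\<close> swaps the factors, and all three matrices are
    self-adjoint.\<close>
  have XL: "?X * ?L = centering_mat N"
    using arg_cong[OF LX, of mat_adjoint]
    by (simp add: mat_adjoint_mult dims adjoint_laplacian_far_graph adjoint_far_pinv adjoint_centering_mat)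
  \<comment> \<open>Row sums are the action on the constant function 1, whose differences
    vanish.\<close>
  have "(\<Sum>z<N. ?L $$ (x, z)) = 0" if "x < N" for x
    using sum_laplacian_far_graph[of N x r "\<lambda>_. 1"] assms that by simp
  then have "?L * ?X * ?L = ?L"
    using L X by (simp add: assoc_mult_mat[of _ N N _ N _ N] XL mult_centering_mat[of _ N])
  moreover have "?X * ?L * ?X = ?X"
    using L X by (simp add: assoc_mult_mat[of _ N N _ N _ N] LX mult_centering_mat[of _ N] sum_far_pinv_row)
  ultimately show ?thesis
    using X by (simp add: is_moore_penrose_def dims LX XL adjoint_centering_mat)
qed

section \<open>The resistance as a folded sum over frequencies\<close>

lemma unit_vec_diff_quadratic_form:
  fixes A :: "'a :: comm_ring_1 mat"
  assumes A: "A \<in> carrier_mat n n" and ij: "i < n" "j < n"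
  shows "(unit_vec n i - unit_vec n j) \<bullet> (A *\<^sub>v (unit_vec n i - unit_vec n j))
    = A $$ (i, i) - A $$ (i, j) - A $$ (j, i) + A $$ (j, j)"
proof -
  have "A *\<^sub>v (unit_vec n i - unit_vec n j) = col A i - col A j"
    using A ij by (intro eq_vecI) (auto simp: scalar_prod_minus_distrib[of _ n])
  then show ?thesis
    using A ij by (simp add: minus_scalar_prod_distrib[of _ n])
qed

text \<open>For odd \<open>N\<close> the reflection has no fixed point in \<open>1..<N\<close> and
  exchanges the lower and upper halves.\<close>

lemma sum_fold_reflect:
  fixes f :: "nat \<Rightarrow> 'a :: comm_semiring_1"
  assumes "odd N" and "\<And>m. 0 < m \<Longrightarrow> m < N \<Longrightarrow> f (N - m) = f m"
  shows "(\<Sum>m = 1..<N. f m) = 2 * (\<Sum>m = 1..(N - 1) div 2. f m)"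
proof -
  obtain h where N: "N = 2 * h + 1" using assms(1) by (elim oddE)
  have "{1..<N} = {1..h} \<union> {h + 1..<N}" using N by auto
  then have "(\<Sum>m = 1..<N. f m) = sum f {1..h} + sum f {h + 1..<N}"
    by (simp only:) (rule sum.union_disjoint, auto)
  also have "sum f {h + 1..<N} = sum f {1..h}"
    by (rule sum.reindex_bij_witness[where i = "\<lambda>j. N - j" and j = "\<lambda>j. N - j"])
      (use N assms(2) in auto)
  finally show ?thesis using N by (simp add: mult_2)
qed

theorem theorem3p1:
  fixes N r l :: nat
  assumes "odd N" and "N \<ge> 7"
    and "1 \<le> r" and "r \<le> (N - 3) div 2"
    and "l \<in> {1..(N - 1) div 2}"
  shows "effective_resistance (far_graph N r) 0 l =
    4 / real N * (\<Sum>m = 1..(N - 1) div 2.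
      (1 - cos (2 * pi * real m * real l / real N)) /
      ((real N - 2 * real r) + 2 * (\<Sum>j = 1..r. cos (2 * pi * real m * real j / real N))))"
proof -
  let ?X = "far_pinv N r" and ?e = "far_eigenvalue N r"
  let ?f = "\<lambda>m. (1 - cos (2 * pi * real m * real l / real N)) / ?e m"
  have l: "l < N" and N: "0 < N" using assms by auto
  have card: "card (pverts (far_graph N r)) = N" by (simp add: far_graph_def)
  have "is_moore_penrose (laplacian_mat (far_graph N r)) ?X"
    using assms by (intro is_moore_penrose_far_pinv) auto
  then have "effective_resistance (far_graph N r) 0 l
      = ?X $$ (0, 0) - ?X $$ (0, l) - ?X $$ (l, 0) + ?X $$ (l, l)"
    unfolding effective_resistance_def Let_def card
    using l N by (simp only: pseudoinverse_eqI)
      (rule unit_vec_diff_quadratic_form, simp_all add: far_pinv_def)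
  \<comment> \<open>The two diagonal entries give the 1 and the two off-diagonal entries the cosine,
    hence the factor 2; folding doubles it to 4.\<close>
  also have "\<dots> = 2 / real N * (\<Sum>m = 1..<N. ?f m)"
    using l N by (simp add: far_pinv_def diff_divide_distrib sum_subtractf)
  also have "(\<Sum>m = 1..<N. ?f m) = 2 * (\<Sum>m = 1..(N - 1) div 2. ?f m)"
  proof (rule sum_fold_reflect)
    fix m assume "0 < m" and "m < N"
    then show "?f (N - m) = ?f m"
      using cos_reflect[of m N "int l"] far_eigenvalue_reflect[of m N r]
      by (simp del: of_nat_diff)
  qed fact
  also have "(\<Sum>m = 1..(N - 1) div 2. ?f m) = (\<Sum>m = 1..(N - 1) div 2.
      (1 - cos (2 * pi * real m * real l / real N)) /
      ((real N - 2 * real r) + 2 * (\<Sum>j = 1..r. cos (2 * pi * real m * real j / real N))))"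
    using assms by (intro sum.cong refl) (subst far_eigenvalue_eq, auto)
  finally show ?thesis by simp
qed

end
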